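(* Consider the scheduling Markov decision process described in the context, with optimal action-value function $Q$. Let $\mathbf{a}=(a_1,\dots,a_N)$ be any admissible action, let $n\in\{1,\dots,N\}$ and $m\in\{1,\dots,M\}$, and let $\mathbf{s}=(\bm{\tau},\mathbf{H})$ and $\mathbf{s}'_{\mathrm{Ch}}=(\bm{\tau},\mathbf{H}'_{n,m})$ be states with the same AoI vector $\bm{\tau}$, where $\mathbf{H}'_{n,m}$ is identical to $\mathbf{H}$ except that its $(n,m)$ entry is $h'_{n,m}$ instead of $h_{n,m}$, with $h'_{n,m}>h_{n,m}$. (i) If $a_n=m$, then $Q(\mathbf{s}'_{\mathrm{Ch}},\mathbf{a})\le Q(\mathbf{s},\mathbf{a})$. (ii) If $a_n\neq m$, then $Q(\mathbf{s}'_{\mathrm{Ch}},\mathbf{a})=Q(\mathbf{s},\mathbf{a})$.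
   Context: Setting. There are $N$ devices and $M<N$ channels; $\hat h\ge 1$ is an integer, $\mathcal{H}=\{1,\dots,\hat h\}$, and $\gamma\in(0,1)$ is a discount factor. States. A state is $\mathbf{s}=(\bm{\tau},\mathbf{H})$, where $\bm{\tau}=(\tau_1,\dots,\tau_N)$ with each $\tau_n\in\{1,2,3,\dots\}$ (the age of information, AoI, of device $n$), and $\mathbf{H}=(h_{n,m})$ is an $N\times M$ matrix with entries in $\mathcal{H}$ (the channel states). Actions. An admissible action is $\mathbf{a}=(a_1,\dots,a_N)\in\{0,1,\dots,M\}^N$ such that for every $m\in\{1,\dots,M\}$ there is exactly one $n$ with $a_n=m$. Here $a_n=m\ge 1$ means device $n$ is scheduled on channel $m$, and $a_n=0$ means device $n$ is not scheduled. Packet drop probabilities. For each pair $(n,m)$ the packet drop probability $p_{n,m}\in[0,1]$ is a function of the channel state $h_{n,m}$ only, and it is non-decreasing in $h_{n,m}$ (a higher channel state means a larger drop probability). Transitions. The channel matrices are i.i.d. over time, with a fixed law $\operatorname{Pr}(\mathbf{H}^+)$ on $\mathcal{H}^{N\times M}$ whose entries have given distributions $\operatorname{Pr}(h_{n,m}=j)=q^{(n,m)}_j$, $\sum_{j=1}^{\hat h}q^{(n,m)}_j=1$. From state $\mathbf{s}=(\bm{\tau},\mathbf{H})$ under action $\mathbf{a}$, the next state $\mathbf{s}^+=(\bm{\tau}^+,\mathbf{H}^+)$ has probability $$\operatorname{Pr}(\mathbf{s}^+\mid\mathbf{s},\mathbf{a})=\operatorname{Pr}(\mathbf{H}^+)\prod_{n=1}^N\operatorname{Pr}(\tau_n^+\mid\tau_n,\mathbf{H},a_n),$$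 where, if $a_n=m\ge1$, $\tau_n^+=1$ with probability $1-p_{n,m}$ and $\tau_n^+=\tau_n+1$ with probability $p_{n,m}$ (with $p_{n,m}$ evaluated at the current $h_{n,m}$), and, if $a_n=0$, $\tau_n^+=\tau_n+1$ with probability $1$. Reward. $r(\mathbf{s})=-\sum_{n=1}^N g_n(\tau_n)$, where each $g_n:\{1,2,\dots\}\to(0,\infty)$ is a positive non-decreasing function. Value functions. Let $\pi^*$ be an optimal stationary policy, i.e. a map from states to admissible actions that attains, from every initial state, the maximum over all policies of the expected discounted total reward. It is assumed that $\pi^*$ exists and that the value functions below are finite (real-valued). Define $$V(\mathbf{s})=\mathbb{E}\Big[\sum_{t'=t}^\infty\gamma^{t'-t}r(\mathbf{s}_{t'})\,\Big|\,\mathbf{s}_t=\mathbf{s},\ \mathbf{a}_{t'}=\pi^*(\mathbf{s}_{t'})\ \forall t'\ge t\Big],$$ $$Q(\mathbf{s},\mathbf{a})=\mathbb{E}\Big[\sum_{t'=t}^\infty\gamma^{t'-t}r(\mathbf{s}_{t'})\,\Big|\,\mathbf{s}_t=\mathbf{s},\ \mathbf{a}_t=\mathbf{a},\ \mathbf{a}_{t'}=\pi^*(\mathbf{s}_{t'})\ \forall t'>t\Big],$$ so that $Q(\mathbf{s},\mathbf{a})=r(\mathbf{s})+\gamma\sum_{\mathbf{s}^+}\operatorname{Pr}(\mathbf{s}^+\mid\mathbf{s},\mathbf{a})V(\mathbf{s}^+)$. *)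

theory Defs
  imports "HOL-Probability.Probability"
begin

text \<open>
  A policy may be randomised and may depend on the whole history: it is given the list of past
  state-action pairs (oldest first) and the current state.
\<close>

type_synonym ('s, 'a) policy = "('s \<times> 'a) list \<Rightarrow> 's \<Rightarrow> 'a pmf"

definition policies :: "'s set \<Rightarrow> 'a set \<Rightarrow> ('s, 'a) policy set" where
  "policies S A = {\<pi>. \<forall>hist. \<forall>s\<in>S. set_pmf (\<pi> hist s) \<subseteq> A}"

definition stationary :: "('s \<Rightarrow> 'a) \<Rightarrow> ('s, 'a) policy" where
  "stationary d = (\<lambda>hist s. return_pmf (d s))"

definition first_action :: "'a \<Rightarrow> ('s, 'a) policy \<Rightarrow> ('s, 'a) policy" where
  "first_action a \<pi> = (\<lambda>hist s. if hist = [] then return_pmf a else \<pi> hist s)"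

text \<open>
  The law of the state-action pair at time \<open>t\<close> given the trajectory \<open>\<omega>\<close> up to (excluding) time
  \<open>t\<close>; the process starts in \<open>s0\<close> at time \<open>0\<close>.
\<close>

definition step_pmf ::
    "('s \<Rightarrow> 'a \<Rightarrow> 's pmf) \<Rightarrow> ('s, 'a) policy \<Rightarrow> 's \<Rightarrow> nat \<Rightarrow> (nat \<Rightarrow> 's \<times> 'a) \<Rightarrow> ('s \<times> 'a) pmf" where
  "step_pmf K \<pi> s0 t \<omega> =
     bind_pmf (if t = 0 then return_pmf s0 else K (fst (\<omega> (t - 1))) (snd (\<omega> (t - 1))))
       (\<lambda>s. map_pmf (Pair s) (\<pi> (map \<omega> [0..<t]) s))"

lemma Ionescu_Tulcea_step_pmf:
  fixes K :: "'s::countable \<Rightarrow> 'a::countable \<Rightarrow> 's pmf"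
  shows "Ionescu_Tulcea (\<lambda>t \<omega>. measure_pmf (step_pmf K \<pi> s0 t \<omega>)) (\<lambda>_. count_space UNIV)"
proof
  fix t :: nat
  have *: "PiM {0..<t} (\<lambda>_. count_space (UNIV :: ('s \<times> 'a) set)) =
      count_space (PiE {0..<t} (\<lambda>_. UNIV))"
    by (rule count_space_PiM_finite) auto
  show "(\<lambda>\<omega>. measure_pmf (step_pmf K \<pi> s0 t \<omega>))
      \<in> measurable (PiM {0..<t} (\<lambda>_. count_space UNIV)) (subprob_algebra (count_space UNIV))"
    unfolding * by (auto simp: space_subprob_algebra intro!: measure_pmf.subprob_space_axioms)
qed

text \<open>The Ionescu-Tulcea measure on infinite state-action trajectories.\<close>

definition trajectory_law ::
    "('s::countable \<Rightarrow> 'a::countable \<Rightarrow> 's pmf) \<Rightarrow> ('s, 'a) policy \<Rightarrow> 's \<Rightarrow> (nat \<Rightarrow> 's \<times> 'a) measure"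
  where
  "trajectory_law K \<pi> s0 = projective_family.lim UNIV
     (Ionescu_Tulcea.CI (\<lambda>t \<omega>. measure_pmf (step_pmf K \<pi> s0 t \<omega>)) (\<lambda>_. count_space UNIV))
     (\<lambda>_. count_space UNIV)"

lemma sets_trajectory_law [measurable_cong]:
  "sets (trajectory_law K \<pi> s0) = sets (PiM UNIV (\<lambda>_. count_space UNIV))"
proof -
  interpret IT: Ionescu_Tulcea "\<lambda>t \<omega>. measure_pmf (step_pmf K \<pi> s0 t \<omega>)" "\<lambda>_. count_space UNIV"
    by (rule Ionescu_Tulcea_step_pmf)
  show ?thesis
    unfolding trajectory_law_def by simp
qed

lemma prob_space_trajectory_law: "prob_space (trajectory_law K \<pi> s0)"
proof -
  interpret IT: Ionescu_Tulcea "\<lambda>t \<omega>. measure_pmf (step_pmf K \<pi> s0 t \<omega>)" "\<lambda>_. count_space UNIV"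
    by (rule Ionescu_Tulcea_step_pmf)
  show ?thesis
    unfolding trajectory_law_def by (rule prob_space_distrD[of "\<lambda>x. restrict x {}" _ "PiM {} (\<lambda>_. count_space UNIV)"])
       (auto simp: IT.distr_lim IT.PF.prob_space_P
           measurable_cong_sets[OF IT.PF.sets_lim refl] intro!: measurable_restrict)
qed

text \<open>
  Expected discounted total reward for a non-positive reward function \<open>r\<close>. The integrand is
  the negative of the discounted return, so the value always exists in \<open>[-\<infinity>, 0]\<close>. When it is
  finite, it is the ordinary expectation of the discounted return, see
  \<open>expected_return_eq_integral\<close>.
\<close>

definition expected_return ::
    "real \<Rightarrow> ('s::countable \<Rightarrow> 'a::countable \<Rightarrow> 's pmf) \<Rightarrow> ('s \<Rightarrow> real) \<Rightarrow> ('s, 'a) policy \<Rightarrow> 's \<Rightarrow> ereal"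
  where
  "expected_return \<gamma> K r \<pi> s0 =
     - enn2ereal (\<integral>\<^sup>+\<omega>. (\<Sum>t. ennreal (\<gamma> ^ t * (- r (fst (\<omega> t))))) \<partial>trajectory_law K \<pi> s0)"

lemma expected_return_eq_integral:
  assumes r: "AE \<omega> in trajectory_law K \<pi> s0. \<forall>t. 0 \<le> \<gamma> ^ t * (- r (fst (\<omega> t)))"
    and fin: "\<bar>expected_return \<gamma> K r \<pi> s0\<bar> \<noteq> \<infinity>"
  shows "AE \<omega> in trajectory_law K \<pi> s0. summable (\<lambda>t. \<gamma> ^ t * r (fst (\<omega> t)))"
    and "integrable (trajectory_law K \<pi> s0) (\<lambda>\<omega>. \<Sum>t. \<gamma> ^ t * r (fst (\<omega> t)))"
    and "expected_return \<gamma> K r \<pi> s0 =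
      ereal (\<integral>\<omega>. (\<Sum>t. \<gamma> ^ t * r (fst (\<omega> t))) \<partial>trajectory_law K \<pi> s0)"
proof -
  let ?M = "trajectory_law K \<pi> s0"
  let ?f = "\<lambda>\<omega> t. \<gamma> ^ t * (- r (fst (\<omega> t)))"
  have meas [measurable]: "(\<lambda>\<omega>. r (fst (\<omega> t))) \<in> borel_measurable ?M" for t
    by measurable
  have fin': "(\<integral>\<^sup>+\<omega>. (\<Sum>t. ennreal (?f \<omega> t)) \<partial>?M) \<noteq> \<infinity>"
    using fin by (auto simp: expected_return_def)
  have "AE \<omega> in ?M. (\<Sum>t. ennreal (?f \<omega> t)) \<noteq> \<infinity>"
    by (rule nn_integral_PInf_AE[OF _ fin']) measurable
  with r have AE: "AE \<omega> in ?M. (\<forall>t. 0 \<le> ?f \<omega> t) \<and> summable (?f \<omega>)"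
  proof eventually_elim
    case (elim \<omega>)
    then show ?case
      by (intro conjI summable_suminf_not_top) (simp_all del: mult_minus_right)
  qed
  have neg: "(\<Sum>t. \<gamma> ^ t * r (fst (\<omega> t))) = - (\<Sum>t. ?f \<omega> t)" if "summable (?f \<omega>)" for \<omega>
    using suminf_minus[OF that] by simp
  show "AE \<omega> in ?M. summable (\<lambda>t. \<gamma> ^ t * r (fst (\<omega> t)))"
    using AE
  proof eventually_elim
    case (elim \<omega>)
    then have "summable (\<lambda>t. - ?f \<omega> t)" by (intro summable_minus) blast
    then show ?case by simp
  qed
  have eq: "(\<integral>\<^sup>+\<omega>. (\<Sum>t. ennreal (?f \<omega> t)) \<partial>?M) = (\<integral>\<^sup>+\<omega>. ennreal (\<Sum>t. ?f \<omega> t) \<partial>?M)"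
  proof (rule nn_integral_cong_AE)
    show "AE \<omega> in ?M. (\<Sum>t. ennreal (?f \<omega> t)) = ennreal (\<Sum>t. ?f \<omega> t)"
      using AE by eventually_elim (rule suminf_ennreal2, blast+)
  qed
  have pos: "AE \<omega> in ?M. 0 \<le> (\<Sum>t. ?f \<omega> t)"
    using AE by eventually_elim (intro suminf_nonneg, blast+)
  have int: "integrable ?M (\<lambda>\<omega>. \<Sum>t. ?f \<omega> t)"
  proof (rule integrableI_nonneg[OF _ pos])
    show "(\<integral>\<^sup>+\<omega>. ennreal (\<Sum>t. ?f \<omega> t) \<partial>?M) < \<infinity>"
      using fin' unfolding eq by (simp add: top.not_eq_extremum)
  qed measurable
  have AEneg: "AE \<omega> in ?M. - (\<Sum>t. ?f \<omega> t) = (\<Sum>t. \<gamma> ^ t * r (fst (\<omega> t)))"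
    using AE by eventually_elim (simp only: neg)
  have "integrable ?M (\<lambda>\<omega>. - (\<Sum>t. ?f \<omega> t))"
    using int by (rule integrable_minus)
  then show "integrable ?M (\<lambda>\<omega>. \<Sum>t. \<gamma> ^ t * r (fst (\<omega> t)))"
    by (rule integrable_cong_AE_imp[OF _ _ AEneg]) measurable
  have "(\<integral>\<omega>. - (\<Sum>t. ?f \<omega> t) \<partial>?M) = (\<integral>\<omega>. (\<Sum>t. \<gamma> ^ t * r (fst (\<omega> t))) \<partial>?M)"
    by (rule integral_cong_AE[OF _ _ AEneg]) measurable
  then have I: "(\<integral>\<omega>. (\<Sum>t. \<gamma> ^ t * r (fst (\<omega> t))) \<partial>?M) = - (\<integral>\<omega>. (\<Sum>t. ?f \<omega> t) \<partial>?M)"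
    unfolding Bochner_Integration.integral_minus by (rule sym)
  show "expected_return \<gamma> K r \<pi> s0 = ereal (\<integral>\<omega>. (\<Sum>t. \<gamma> ^ t * r (fst (\<omega> t))) \<partial>?M)"
    unfolding expected_return_def eq nn_integral_eq_integral[OF int pos] I
    using integral_nonneg_AE[OF pos] by (simp only: enn2ereal_ennreal uminus_ereal.simps)
qed

definition optimal_stationary_policy ::
    "real \<Rightarrow> ('s::countable \<Rightarrow> 'a::countable \<Rightarrow> 's pmf) \<Rightarrow> ('s \<Rightarrow> real) \<Rightarrow> 's set \<Rightarrow> 'a set \<Rightarrow> ('s \<Rightarrow> 'a) \<Rightarrow> bool"
  where
  "optimal_stationary_policy \<gamma> K r S A d \<longleftrightarrow>
     (\<forall>s\<in>S. d s \<in> A) \<and>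
     (\<forall>s\<in>S. \<forall>\<pi>\<in>policies S A. expected_return \<gamma> K r \<pi> s \<le> expected_return \<gamma> K r (stationary d) s)"

definition V_fun ::
    "real \<Rightarrow> ('s::countable \<Rightarrow> 'a::countable \<Rightarrow> 's pmf) \<Rightarrow> ('s \<Rightarrow> real) \<Rightarrow> ('s \<Rightarrow> 'a) \<Rightarrow> 's \<Rightarrow> ereal"
  where
  "V_fun \<gamma> K r d s = expected_return \<gamma> K r (stationary d) s"

definition Q_fun ::
    "real \<Rightarrow> ('s::countable \<Rightarrow> 'a::countable \<Rightarrow> 's pmf) \<Rightarrow> ('s \<Rightarrow> real) \<Rightarrow> ('s \<Rightarrow> 'a) \<Rightarrow> 's \<Rightarrow> 'a \<Rightarrow> ereal"
  where
  "Q_fun \<gamma> K r d s a = expected_return \<gamma> K r (first_action a (stationary d)) s"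


text \<open>
  Devices are the elements of the finite type \<open>'n\<close>, channels those of the finite type \<open>'m\<close>.
  A state consists of the AoI vector and the channel matrix. In an action, \<open>None\<close> stands for
  \<open>0\<close> (not scheduled).
\<close>

type_synonym ('n, 'm) state = "('n \<Rightarrow> nat) \<times> ('n \<Rightarrow> 'm \<Rightarrow> nat)"
type_synonym ('n, 'm) action = "'n \<Rightarrow> 'm option"

definition channel_matrices :: "nat \<Rightarrow> ('n \<Rightarrow> 'm \<Rightarrow> nat) set" where
  "channel_matrices hmax = {H. \<forall>n m. H n m \<in> {1..hmax}}"

definition states :: "nat \<Rightarrow> ('n, 'm) state set" where
  "states hmax = {\<tau>. \<forall>n. 1 \<le> \<tau> n} \<times> channel_matrices hmax"

definition admissible :: "('n, 'm) action set" where
  "admissible = {a. \<forall>m. \<exists>!n. a n = Some m}"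

text \<open>\<open>p n m h\<close> is the packet drop probability of device \<open>n\<close> on channel \<open>m\<close> in channel state \<open>h\<close>.\<close>

definition aoi_step ::
    "('n \<Rightarrow> 'm \<Rightarrow> nat \<Rightarrow> real) \<Rightarrow> ('n, 'm) state \<Rightarrow> ('n, 'm) action \<Rightarrow> 'n \<Rightarrow> nat pmf" where
  "aoi_step p = (\<lambda>(\<tau>, H) a n.
     case a n of
       None \<Rightarrow> return_pmf (\<tau> n + 1)
     | Some m \<Rightarrow> map_pmf (\<lambda>dropped. if dropped then \<tau> n + 1 else 1) (bernoulli_pmf (p n m (H n m))))"

definition transition ::
    "('n::finite \<Rightarrow> 'm \<Rightarrow> nat \<Rightarrow> real) \<Rightarrow> ('n \<Rightarrow> 'm \<Rightarrow> nat) pmf \<Rightarrow>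
      ('n, 'm) state \<Rightarrow> ('n, 'm) action \<Rightarrow> ('n, 'm) state pmf" where
  "transition p PH s a = pair_pmf (Pi_pmf UNIV 0 (aoi_step p s a)) PH"

lemma pmf_transition:
  "pmf (transition p PH s a) (\<tau>', H') = pmf PH H' * (\<Prod>n\<in>UNIV. pmf (aoi_step p s a n) (\<tau>' n))"
  by (simp add: transition_def pmf_pair pmf_Pi)

definition reward :: "('n::finite \<Rightarrow> nat \<Rightarrow> real) \<Rightarrow> ('n, 'm) state \<Rightarrow> real" where
  "reward g = (\<lambda>(\<tau>, H). - (\<Sum>n\<in>UNIV. g n (\<tau> n)))"

end

theory Submission
  imports Defs
begin

text \<open>
  Write \<open>c = -r \<ge> 0\<close> for the cost. Since costs are non-negative and there are finitely many actions,
  value iteration from \<open>0\<close> increases to a function \<open>W\<close> that satisfies the Bellman inequality for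
  some greedy action in every state; hence \<open>W\<close> dominates the cost of the greedy stationary policy,
  and by optimality \<open>W = -V\<close>. Each iterate, and so \<open>W\<close>, is non-decreasing in the AoI vector: the
  successors of two ordered AoI vectors can be coupled monotonically. The same coupling applies when
  a drop probability increases, which with \<open>-Q(s,a) = c(s) + \<gamma> E[W(s\<^sup>+)]\<close> gives (i); in (ii) the two
  transition laws coincide.
\<close>

section \<open>State-action trajectories\<close>

text \<open>Conditioning on the past: the first \<open>Suc t\<close> coordinates are distributed as
  the finite-horizon measure \<open>IT.C 0 (Suc t)\<close>, which arises from
  \<open>IT.C 0 t\<close> by appending one draw from \<open>step_pmf\<close>.\<close>

lemma nn_integral_trajectory_law_component:
  fixes K :: "'s::countable \<Rightarrow> 'a::countable \<Rightarrow> 's pmf" and f :: "'s \<times> 'a \<Rightarrow> ennreal"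
  shows "(\<integral>\<^sup>+\<omega>. f (\<omega> t) \<partial>trajectory_law K \<pi> s0) =
    (\<integral>\<^sup>+\<omega>. (\<integral>\<^sup>+x. f x \<partial>step_pmf K \<pi> s0 t \<omega>) \<partial>trajectory_law K \<pi> s0)"
proof -
  let ?P = "\<lambda>t \<omega>. measure_pmf (step_pmf K \<pi> s0 t \<omega>)"
  let ?M = "\<lambda>_::nat. count_space (UNIV :: ('s \<times> 'a) set)"
  interpret IT: Ionescu_Tulcea ?P ?M
    by (rule Ionescu_Tulcea_step_pmf)
  \<comment> \<open>Finite products of countable discrete spaces are discrete, so measurability on
    finite horizons is automatic.\<close>
  have count: "PiM {0..<k} ?M = count_space (PiE {0..<k} (\<lambda>_. UNIV))" for k :: nat
    by (rule count_space_PiM_finite) auto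
  have marginal: "(\<integral>\<^sup>+\<omega>. F (restrict \<omega> {0..<k}) \<partial>trajectory_law K \<pi> s0) =
      (\<integral>\<^sup>+\<omega>. F \<omega> \<partial>IT.C 0 k (\<lambda>_. undefined))" for F :: "(nat \<Rightarrow> 's \<times> 'a) \<Rightarrow> ennreal" and k
  proof -
    have F: "F \<in> borel_measurable (PiM {0..<k} ?M)"
      unfolding count by simp
    \<comment> \<open>\<open>IT.CI\<close> is built from \<open>IT.C\<close> with horizon
      \<open>IT.up_to\<close>, the least bound of the index set.\<close>
    have up_to: "IT.up_to {0..<k} = k"
    proof (rule antisym)
      show "IT.up_to {0..<k} \<le> k"
        by (simp add: IT.up_to_iff)
      show "k \<le> IT.up_to {0..<k}"
        using IT.up_to_less[of "{0..<k}" "IT.up_to {0..<k}"] by (auto simp: not_less[symmetric])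
    qed
    have restr: "(\<lambda>\<omega>. restrict \<omega> {0..<k}) \<in> measurable (IT.C 0 k (\<lambda>_. undefined)) (PiM {0..<k} ?M)"
      by (subst measurable_cong_sets[OF IT.sets_C refl]) (auto intro!: measurable_restrict)
    have "(\<integral>\<^sup>+\<omega>. F (restrict \<omega> {0..<k}) \<partial>trajectory_law K \<pi> s0) =
        (\<integral>\<^sup>+\<omega>. F \<omega> \<partial>distr IT.PF.lim (PiM {0..<k} ?M) (\<lambda>\<omega>. restrict \<omega> {0..<k}))"
      unfolding trajectory_law_def
      by (subst nn_integral_distr)
        (auto simp: F measurable_cong_sets[OF IT.PF.sets_lim refl] intro!: measurable_restrict)
    also have "\<dots> = (\<integral>\<^sup>+\<omega>. F (restrict \<omega> {0..<k}) \<partial>IT.C 0 k (\<lambda>_. undefined))"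
      by (simp add: IT.distr_lim IT.CI_def up_to nn_integral_distr[OF restr] F)
    also have "\<dots> = (\<integral>\<^sup>+\<omega>. F \<omega> \<partial>IT.C 0 k (\<lambda>_. undefined))"
      by (rule nn_integral_cong) (auto simp: IT.space_C space_PiM PiE_iff extensional_restrict)
    finally show ?thesis .
  qed
  \<comment> \<open>The kernel reads only coordinates before \<open>t\<close>, so it does not see
    the restriction in \<open>marginal\<close>.\<close>
  have step: "step_pmf K \<pi> s0 t (restrict \<omega> {0..<t}) = step_pmf K \<pi> s0 t \<omega>" for \<omega>
  proof -
    have *: "map (restrict \<omega> {0..<t}) [0..<t] = map \<omega> [0..<t]"
      by (rule map_cong) auto
    show ?thesis
      unfolding step_pmf_def * by simp
  qed
  have last: "(\<lambda>\<omega>. f (\<omega> t)) \<in> borel_measurable (PiM {0..<Suc t} ?M)"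
    by (simp add: count)
  have eP: "IT.eP t \<in> measurable (IT.C 0 t (\<lambda>_. undefined)) (subprob_algebra (PiM {0..<Suc t} ?M))"
    using IT.measurable_eP[of t] by (subst measurable_cong_sets[OF IT.sets_C refl]) simp_all
  have "(\<integral>\<^sup>+\<omega>. f (\<omega> t) \<partial>trajectory_law K \<pi> s0) = (\<integral>\<^sup>+\<omega>. f (\<omega> t) \<partial>IT.C 0 (Suc t) (\<lambda>_. undefined))"
    using marginal[of "\<lambda>\<omega>. f (\<omega> t)" "Suc t"] by simp
  also have "\<dots> = (\<integral>\<^sup>+\<omega>. (\<integral>\<^sup>+\<omega>'. f (\<omega>' t) \<partial>IT.eP t \<omega>) \<partial>IT.C 0 t (\<lambda>_. undefined))"
    by (simp add: nn_integral_bind[OF last eP])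
  \<comment> \<open>\<open>IT.eP t \<omega>\<close> extends \<open>\<omega>\<close> by a draw at
    coordinate \<open>t\<close>, the only one that the integrand reads.\<close>
  also have "\<dots> = (\<integral>\<^sup>+\<omega>. (\<integral>\<^sup>+x. f x \<partial>step_pmf K \<pi> s0 t \<omega>) \<partial>IT.C 0 t (\<lambda>_. undefined))"
    by (rule nn_integral_cong, subst IT.nn_integral_eP) (auto simp: IT.space_C count)
  also have "\<dots> = (\<integral>\<^sup>+\<omega>. (\<integral>\<^sup>+x. f x \<partial>step_pmf K \<pi> s0 t \<omega>) \<partial>trajectory_law K \<pi> s0)"
    by (simp only: marginal[symmetric] step)
  finally show ?thesis .
qed

section \<open>Costs of stationary policies and their Bellman equation\<close>

definition policy_step ::
    "('s \<Rightarrow> 'a \<Rightarrow> 's pmf) \<Rightarrow> ('s \<Rightarrow> 'a) \<Rightarrow> ('s \<Rightarrow> ennreal) \<Rightarrow> 's \<Rightarrow> ennreal" where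
  "policy_step K d f s = (\<integral>\<^sup>+s'. f s' \<partial>K s (d s))"

text \<open>The history is empty at time 0 only; from then on \<open>d\<close> acts and the process
  is Markov.\<close>

lemma step_pmf_first_action:
  "step_pmf K (first_action a \<pi>) s0 0 \<omega> = return_pmf (s0, a)"
  "step_pmf K (first_action a (stationary d)) s0 (Suc t) \<omega> =
    map_pmf (\<lambda>s. (s, d s)) (K (fst (\<omega> t)) (snd (\<omega> t)))"
  by (simp_all add: step_pmf_def first_action_def stationary_def bind_return_pmf map_pmf_def)

lemma nn_integral_trajectory_law_first_action_0:
  fixes K :: "'s::countable \<Rightarrow> 'a::countable \<Rightarrow> 's pmf" and f :: "'s \<times> 'a \<Rightarrow> ennreal"
  shows "(\<integral>\<^sup>+\<omega>. f (\<omega> 0) \<partial>trajectory_law K (first_action a \<pi>) s0) = f (s0, a)"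
proof -
  interpret prob_space "trajectory_law K (first_action a \<pi>) s0"
    by (rule prob_space_trajectory_law)
  show ?thesis
    by (subst nn_integral_trajectory_law_component)
       (simp add: step_pmf_first_action emeasure_space_1)
qed

text \<open>Iterated conditioning. The induction generalises \<open>f\<close> because each step
  backwards in time replaces \<open>f\<close> by its conditional expectation given the previous
  pair.\<close>

lemma nn_integral_trajectory_law_first_action_Suc:
  fixes K :: "'s::countable \<Rightarrow> 'a::countable \<Rightarrow> 's pmf" and f :: "'s \<times> 'a \<Rightarrow> ennreal"
  shows "(\<integral>\<^sup>+\<omega>. f (\<omega> (Suc t)) \<partial>trajectory_law K (first_action a (stationary d)) s0) =
    (\<integral>\<^sup>+s. (policy_step K d ^^ t) (\<lambda>s. f (s, d s)) s \<partial>K s0 a)"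
proof (induction t arbitrary: f)
  case 0
  show ?case
    by (subst nn_integral_trajectory_law_component)
       (simp add: step_pmf_first_action
         nn_integral_trajectory_law_first_action_0[where f="\<lambda>x. \<integral>\<^sup>+s. f (s, d s) \<partial>K (fst x) (snd x)"])
next
  case (Suc t)
  have "(\<integral>\<^sup>+\<omega>. f (\<omega> (Suc (Suc t))) \<partial>trajectory_law K (first_action a (stationary d)) s0) =
      (\<integral>\<^sup>+\<omega>. (\<integral>\<^sup>+s. f (s, d s) \<partial>K (fst (\<omega> (Suc t))) (snd (\<omega> (Suc t))))
        \<partial>trajectory_law K (first_action a (stationary d)) s0)"
    by (subst nn_integral_trajectory_law_component) (simp add: step_pmf_first_action)
  also have "\<dots> = (\<integral>\<^sup>+s. (policy_step K d ^^ t) (policy_step K d (\<lambda>s. f (s, d s))) s \<partial>K s0 a)"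
    using Suc.IH[of "\<lambda>x. \<integral>\<^sup>+s. f (s, d s) \<partial>K (fst x) (snd x)"]
    by (simp add: policy_step_def[abs_def])
  finally show ?case
    by (simp add: funpow_swap1)
qed

text \<open>The expected discounted cost with sum and expectation interchanged. Values in
  \<open>ennreal\<close> avoid all convergence conditions; \<open>V_fun_eq\<close> identifies it
  with the negative of the value.\<close>

definition policy_cost ::
    "real \<Rightarrow> ('s \<Rightarrow> 'a \<Rightarrow> 's pmf) \<Rightarrow> ('s \<Rightarrow> real) \<Rightarrow> ('s \<Rightarrow> 'a) \<Rightarrow> 's \<Rightarrow> ennreal" where
  "policy_cost \<gamma> K r d s = (\<Sum>t. ennreal (\<gamma> ^ t) * (policy_step K d ^^ t) (\<lambda>s. ennreal (- r s)) s)"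

text \<open>Tonelli turns the expected return into a series of expectations. Its term at time 0 is
  the immediate cost, and the rest carries a common factor \<open>\<gamma>\<close>.\<close>

lemma Q_fun_eq:
  fixes K :: "'s::countable \<Rightarrow> 'a::countable \<Rightarrow> 's pmf"
  assumes "0 \<le> \<gamma>"
  shows "Q_fun \<gamma> K r d s a =
    - enn2ereal (ennreal (- r s) + ennreal \<gamma> * (\<integral>\<^sup>+s'. policy_cost \<gamma> K r d s' \<partial>K s a))"
proof -
  let ?L = "trajectory_law K (first_action a (stationary d)) s"
  let ?c = "\<lambda>s. ennreal (- r s)"
  have "(\<integral>\<^sup>+\<omega>. (\<Sum>t. ennreal (\<gamma> ^ t * (- r (fst (\<omega> t))))) \<partial>?L) =
      (\<integral>\<^sup>+\<omega>. (\<Sum>t. ennreal (\<gamma> ^ t) * ?c (fst (\<omega> t))) \<partial>?L)"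
    \<comment> \<open>Non-negativity of \<open>\<gamma> ^ t\<close> suffices to split the product:
      where the reward is positive, both sides are truncated to 0.\<close>
    using assms by (simp only: ennreal_mult' zero_le_power)
  also have "\<dots> = (\<Sum>t. ennreal (\<gamma> ^ t) * (\<integral>\<^sup>+\<omega>. ?c (fst (\<omega> t)) \<partial>?L))"
    by (subst nn_integral_suminf) (measurable, simp add: nn_integral_cmult)
  also have "\<dots> = ?c s + (\<Sum>t. ennreal (\<gamma> ^ Suc t) * (\<integral>\<^sup>+\<omega>. ?c (fst (\<omega> (Suc t))) \<partial>?L))"
    by (subst suminf_offset[of _ 1])
       (auto simp: nn_integral_trajectory_law_first_action_0[where f="\<lambda>x. ?c (fst x)"])
  also have "(\<Sum>t. ennreal (\<gamma> ^ Suc t) * (\<integral>\<^sup>+\<omega>. ?c (fst (\<omega> (Suc t))) \<partial>?L)) =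
      (\<Sum>t. ennreal \<gamma> * (ennreal (\<gamma> ^ t) * (\<integral>\<^sup>+s'. (policy_step K d ^^ t) ?c s' \<partial>K s a)))"
    using assms
    by (simp add: nn_integral_trajectory_law_first_action_Suc[where f="\<lambda>x. ?c (fst x)"] ennreal_mult mult.assoc)
  also have "\<dots> = ennreal \<gamma> * (\<integral>\<^sup>+s'. policy_cost \<gamma> K r d s' \<partial>K s a)"
    by (simp add: policy_cost_def nn_integral_suminf nn_integral_cmult)
  finally show ?thesis
    by (simp add: Q_fun_def expected_return_def)
qed

lemma policy_cost_rec:
  assumes "0 \<le> \<gamma>"
  shows "policy_cost \<gamma> K r d s =
    ennreal (- r s) + ennreal \<gamma> * (\<integral>\<^sup>+s'. policy_cost \<gamma> K r d s' \<partial>K s (d s))"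
proof -
  let ?c = "\<lambda>s. ennreal (- r s)"
  have "policy_cost \<gamma> K r d s =
      ?c s + (\<Sum>t. ennreal \<gamma> * (ennreal (\<gamma> ^ t) * (\<integral>\<^sup>+s'. (policy_step K d ^^ t) ?c s' \<partial>K s (d s))))"
    unfolding policy_cost_def
    by (subst suminf_offset[of _ 1])
       (auto simp: ennreal_mult assms mult.assoc policy_step_def)
  also have "(\<Sum>t. ennreal \<gamma> * (ennreal (\<gamma> ^ t) * (\<integral>\<^sup>+s'. (policy_step K d ^^ t) ?c s' \<partial>K s (d s)))) =
      ennreal \<gamma> * (\<integral>\<^sup>+s'. policy_cost \<gamma> K r d s' \<partial>K s (d s))"
    by (simp add: policy_cost_def nn_integral_suminf nn_integral_cmult)
  finally show ?thesis .
qed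

lemma V_fun_eq:
  fixes K :: "'s::countable \<Rightarrow> 'a::countable \<Rightarrow> 's pmf"
  assumes "0 \<le> \<gamma>"
  shows "V_fun \<gamma> K r d s = - enn2ereal (policy_cost \<gamma> K r d s)"
proof -
  \<comment> \<open>The initial state is fixed, so forcing the first action to be \<open>d s\<close>
    changes nothing, and \<open>V\<close> becomes an instance of \<open>Q\<close>.\<close>
  have step: "step_pmf K (stationary d) s = step_pmf K (first_action (d s) (stationary d)) s"
    by (intro ext) (auto simp: step_pmf_def first_action_def stationary_def bind_return_pmf)
  have "V_fun \<gamma> K r d s = Q_fun \<gamma> K r d s (d s)"
    by (simp add: V_fun_def Q_fun_def expected_return_def trajectory_law_def step)
  then show ?thesis
    by (simp add: Q_fun_eq assms policy_cost_rec[of \<gamma> K r d s])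
qed


text \<open>A supersolution of the Bellman equation of \<open>d\<close> dominates its cost: by
  induction on the horizon it dominates every partial sum, starting from the empty sum 0.\<close>

lemma policy_cost_le:
  fixes K :: "'s \<Rightarrow> 'a \<Rightarrow> 's pmf"
  assumes "0 \<le> \<gamma>"
    and W: "\<And>s. ennreal (- r s) + ennreal \<gamma> * (\<integral>\<^sup>+s'. W s' \<partial>K s (d s)) \<le> W s"
  shows "policy_cost \<gamma> K r d s \<le> W s"
proof -
  let ?u = "\<lambda>s t. ennreal (\<gamma> ^ t) * (policy_step K d ^^ t) (\<lambda>s. ennreal (- r s)) s"
  have "(\<Sum>t<T. ?u s t) \<le> W s" for T
  proof (induction T arbitrary: s)
    case (Suc T)
    have "(\<Sum>t<Suc T. ?u s t) =
        ennreal (- r s) + ennreal \<gamma> * (\<integral>\<^sup>+s'. (\<Sum>t<T. ?u s' t) \<partial>K s (d s))"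
      by (simp add: sum.lessThan_Suc_shift nn_integral_sum nn_integral_cmult policy_step_def
          ennreal_mult assms(1) sum_distrib_left mult.assoc del: sum.lessThan_Suc)
    also have "\<dots> \<le> ennreal (- r s) + ennreal \<gamma> * (\<integral>\<^sup>+s'. W s' \<partial>K s (d s))"
      by (intro add_left_mono mult_left_mono nn_integral_mono Suc.IH) simp
    finally show ?case
      using W[of s] by (rule order_trans)
  qed simp
  then show ?thesis
    unfolding policy_cost_def suminf_eq_SUP by (intro SUP_least)
qed


section \<open>Value iteration\<close>

primrec value_iteration ::
    "real \<Rightarrow> ('s \<Rightarrow> 'a \<Rightarrow> 's pmf) \<Rightarrow> ('s \<Rightarrow> real) \<Rightarrow> 'a set \<Rightarrow> nat \<Rightarrow> 's \<Rightarrow> ennreal" where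
  "value_iteration \<gamma> K r A 0 = (\<lambda>s. 0)"
| "value_iteration \<gamma> K r A (Suc T) = (\<lambda>s. ennreal (- r s) +
     ennreal \<gamma> * (INF a\<in>A. \<integral>\<^sup>+s'. value_iteration \<gamma> K r A T s' \<partial>K s a))"

definition limit_cost ::
    "real \<Rightarrow> ('s \<Rightarrow> 'a \<Rightarrow> 's pmf) \<Rightarrow> ('s \<Rightarrow> real) \<Rightarrow> 'a set \<Rightarrow> 's \<Rightarrow> ennreal" where
  "limit_cost \<gamma> K r A s = (SUP T. value_iteration \<gamma> K r A T s)"

text \<open>The Bellman operator is monotone, and its first application lies above the initial
  function 0.\<close>

lemma incseq_value_iteration: "incseq (value_iteration \<gamma> K r A)"
proof (rule incseq_SucI)
  show "value_iteration \<gamma> K r A T \<le> value_iteration \<gamma> K r A (Suc T)" for T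
  proof (induction T)
    case (Suc T)
    show ?case
    proof (rule le_funI)
      fix s
      have "(INF a\<in>A. \<integral>\<^sup>+s'. value_iteration \<gamma> K r A T s' \<partial>K s a) \<le>
          (INF a\<in>A. \<integral>\<^sup>+s'. value_iteration \<gamma> K r A (Suc T) s' \<partial>K s a)"
        by (intro INF_mono' nn_integral_mono le_funD[OF Suc.IH])
      then show "value_iteration \<gamma> K r A (Suc T) s \<le> value_iteration \<gamma> K r A (Suc (Suc T)) s"
        unfolding value_iteration.simps by (intro add_left_mono mult_left_mono) simp_all
    qed
  qed (simp add: le_fun_def)
qed

text \<open>
  Infimum and supremum can be exchanged since, for finite \<open>A\<close>, a single action is a minimiser
  at infinitely many stages.
\<close>

lemma ex_greedy_action:
  fixes K :: "'s \<Rightarrow> 'a \<Rightarrow> 's pmf"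
  assumes "finite A" "A \<noteq> {}"
  shows "\<exists>a\<in>A. ennreal (- r s) + ennreal \<gamma> * (\<integral>\<^sup>+s'. limit_cost \<gamma> K r A s' \<partial>K s a)
    \<le> limit_cost \<gamma> K r A s"
proof -
  let ?W = "value_iteration \<gamma> K r A"
  let ?I = "\<lambda>T a. \<integral>\<^sup>+s'. ?W T s' \<partial>K s a"
  have mono: "?W T s \<le> ?W T' s" if "T \<le> T'" for T T' s
    using incseqD[OF incseq_value_iteration that] by (rule le_funD)
  have "\<exists>a\<in>A. ?I T a = (INF a\<in>A. ?I T a)" for T
  proof -
    have "Min (?I T ` A) \<in> ?I T ` A"
      using assms by (intro Min_in) auto
    then show ?thesis
      using assms by (auto simp: Min_Inf)
  qed
  then obtain b where b: "\<And>T. b T \<in> A" "\<And>T. ?I T (b T) = (INF a\<in>A. ?I T a)"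
    by metis
  have "\<exists>a\<in>A. infinite {T \<in> UNIV. b T = a}"
    using b(1) \<open>finite A\<close> by (intro pigeonhole_infinite_rel) auto
  then obtain a where a: "a \<in> A" "infinite {T. b T = a}"
    by auto
  have "ennreal (- r s) + ennreal \<gamma> * ?I T a \<le> limit_cost \<gamma> K r A s" for T
  proof -
    \<comment> \<open>At a later stage \<open>T'\<close> where \<open>a\<close> is a minimiser, the
      infimum in the next iterate equals the integral for \<open>a\<close>.\<close>
    from a(2) obtain T' where T': "T \<le> T'" "b T' = a"
      using infinite_nat_iff_unbounded_le[of "{T. b T = a}"] by auto
    have "ennreal (- r s) + ennreal \<gamma> * ?I T a \<le> ennreal (- r s) + ennreal \<gamma> * ?I T' a"
      by (intro add_left_mono mult_left_mono nn_integral_mono mono T') simp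
    also have "\<dots> = ?W (Suc T') s"
      using b(2)[of T'] T'(2) by simp
    also have "\<dots> \<le> limit_cost \<gamma> K r A s"
      unfolding limit_cost_def by (rule SUP_upper) simp
    finally show ?thesis .
  qed
  \<comment> \<open>Monotone convergence moves the supremum out of the integral, so the bounds for
    all \<open>T\<close> pass to the limit.\<close>
  moreover have "ennreal (- r s) + ennreal \<gamma> * (\<integral>\<^sup>+s'. limit_cost \<gamma> K r A s' \<partial>K s a) =
      (SUP T. ennreal (- r s) + ennreal \<gamma> * ?I T a)"
    unfolding limit_cost_def
    by (simp add: nn_integral_monotone_convergence_SUP incseq_value_iteration SUP_mult_left_ennreal
        ennreal_SUP_add_right)
  ultimately show ?thesis
    using a(1) by (auto intro!: bexI[of _ a] SUP_least)
qed

text \<open>The action of \<open>d\<close> is one candidate in each infimum, and the cost of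
  \<open>d\<close> solves its Bellman equation. Closedness of \<open>S\<close> keeps the induction
  where \<open>d\<close> is known to take values in \<open>A\<close>.\<close>

lemma value_iteration_le_policy_cost:
  fixes K :: "'s \<Rightarrow> 'a \<Rightarrow> 's pmf"
  assumes "0 \<le> \<gamma>" "\<And>s. s \<in> S \<Longrightarrow> d s \<in> A"
    and closed: "\<And>s a. s \<in> S \<Longrightarrow> a \<in> A \<Longrightarrow> set_pmf (K s a) \<subseteq> S"
  shows "s \<in> S \<Longrightarrow> value_iteration \<gamma> K r A T s \<le> policy_cost \<gamma> K r d s"
proof (induction T arbitrary: s)
  case (Suc T)
  have "(INF a\<in>A. \<integral>\<^sup>+s'. value_iteration \<gamma> K r A T s' \<partial>K s a) \<le>
      (\<integral>\<^sup>+s'. value_iteration \<gamma> K r A T s' \<partial>K s (d s))"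
    using assms(2) Suc.prems by (intro INF_lower)
  also have "\<dots> \<le> (\<integral>\<^sup>+s'. policy_cost \<gamma> K r d s' \<partial>K s (d s))"
    using closed[OF Suc.prems assms(2)[OF Suc.prems]]
    by (intro nn_integral_mono_AE) (auto simp: AE_measure_pmf_iff intro!: Suc.IH)
  finally show ?case
    unfolding value_iteration.simps policy_cost_rec[OF assms(1), of K r d s]
    by (intro add_left_mono mult_left_mono) simp_all
qed simp

text \<open>Optimality is used here, and only against the greedy stationary policy. It gives the
  upper bound; value iteration gives the lower one.\<close>

lemma policy_cost_optimal:
  fixes K :: "'s::countable \<Rightarrow> 'a::countable \<Rightarrow> 's pmf"
  assumes "0 \<le> \<gamma>" "finite A"
    and opt: "optimal_stationary_policy \<gamma> K r S A d"
    and closed: "\<And>s a. s \<in> S \<Longrightarrow> a \<in> A \<Longrightarrow> set_pmf (K s a) \<subseteq> S"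
    and s: "s \<in> S"
  shows "policy_cost \<gamma> K r d s = limit_cost \<gamma> K r A s"
proof (rule antisym)
  have d: "d s \<in> A" if "s \<in> S" for s
    using opt that by (auto simp: optimal_stationary_policy_def)
  then have "A \<noteq> {}"
    using s by auto
  \<comment> \<open>Greedy actions are chosen outside \<open>S\<close> too, since
    \<open>policy_cost_le\<close> asks for the inequality in every state of the type.\<close>
  then have "\<forall>s. \<exists>a\<in>A. ennreal (- r s) + ennreal \<gamma> * (\<integral>\<^sup>+s'. limit_cost \<gamma> K r A s' \<partial>K s a)
      \<le> limit_cost \<gamma> K r A s"
    by (intro allI ex_greedy_action[OF \<open>finite A\<close>])
  then obtain e where e: "\<And>s. e s \<in> A"
      "\<And>s. ennreal (- r s) + ennreal \<gamma> * (\<integral>\<^sup>+s'. limit_cost \<gamma> K r A s' \<partial>K s (e s))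
        \<le> limit_cost \<gamma> K r A s"
    by metis
  have "stationary e \<in> policies S A"
    using e(1) by (auto simp: policies_def stationary_def)
  then have "V_fun \<gamma> K r e s \<le> V_fun \<gamma> K r d s"
    using opt s by (auto simp: optimal_stationary_policy_def V_fun_def)
  then have "policy_cost \<gamma> K r d s \<le> policy_cost \<gamma> K r e s"
    by (simp add: V_fun_eq assms(1) less_eq_ennreal.rep_eq)
  also have "\<dots> \<le> limit_cost \<gamma> K r A s"
    using assms(1) e(2) by (rule policy_cost_le)
  finally show "policy_cost \<gamma> K r d s \<le> limit_cost \<gamma> K r A s" .
  show "limit_cost \<gamma> K r A s \<le> policy_cost \<gamma> K r d s"
    unfolding limit_cost_def
    using value_iteration_le_policy_cost[OF assms(1) d closed s] by (intro SUP_least)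
qed


section \<open>Stochastic monotonicity of the scheduling model\<close>

text \<open>The product of the coordinatewise couplings \<open>pq\<close> couples the two products;
  its default \<open>(d, d')\<close> projects to the two given defaults.\<close>

lemma rel_pmf_Pi_pmf:
  assumes "finite A" "\<And>x. x \<in> A \<Longrightarrow> rel_pmf (R x) (p x) (q x)"
  shows "rel_pmf (\<lambda>f g. \<forall>x\<in>A. R x (f x) (g x)) (Pi_pmf A d p) (Pi_pmf A d' q)"
proof -
  have "\<forall>x\<in>A. \<exists>pq. (\<forall>(y, z)\<in>set_pmf pq. R x y z) \<and> map_pmf fst pq = p x \<and> map_pmf snd pq = q x"
    using assms(2) by (force elim!: rel_pmf.cases)
  then obtain pq where pq: "\<And>x y z. x \<in> A \<Longrightarrow> (y, z) \<in> set_pmf (pq x) \<Longrightarrow> R x y z"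
      "\<And>x. x \<in> A \<Longrightarrow> map_pmf fst (pq x) = p x" "\<And>x. x \<in> A \<Longrightarrow> map_pmf snd (pq x) = q x"
    by (metis (no_types, lifting) case_prodD)
  let ?J = "Pi_pmf A (d, d') pq"
  have fst: "map_pmf (\<lambda>h. fst \<circ> h) ?J = Pi_pmf A d p"
    using assms(1) pq(2) by (subst Pi_pmf_map[symmetric]) (auto intro!: Pi_pmf_cong)
  have snd: "map_pmf (\<lambda>h. snd \<circ> h) ?J = Pi_pmf A d' q"
    using assms(1) pq(3) by (subst Pi_pmf_map[symmetric]) (auto intro!: Pi_pmf_cong)
  have "rel_pmf (\<lambda>f g. \<forall>x\<in>A. R x (f x) (g x)) (map_pmf (\<lambda>h. fst \<circ> h) ?J) (map_pmf (\<lambda>h. snd \<circ> h) ?J)"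
    unfolding pmf.rel_map
    using pq(1) assms(1) by (intro rel_pmf_reflI) (auto simp: set_Pi_pmf PiE_dflt_def)
  then show ?thesis
    by (simp only: fst snd)
qed

text \<open>Both integrals are taken over a coupling, on which the integrands compare almost
  surely.\<close>

lemma nn_integral_mono_rel_pmf:
  assumes "rel_pmf R p q" "\<And>x y. R x y \<Longrightarrow> f x \<le> g y"
  shows "(\<integral>\<^sup>+x. f x \<partial>measure_pmf p) \<le> (\<integral>\<^sup>+y. g y \<partial>measure_pmf q)"
  using assms(1)
proof cases
  case (1 pq)
  have "(\<integral>\<^sup>+x. f (fst x) \<partial>measure_pmf pq) \<le> (\<integral>\<^sup>+x. g (snd x) \<partial>measure_pmf pq)"
    using 1(1) by (intro nn_integral_mono_AE) (auto simp: AE_measure_pmf_iff intro!: assms(2))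
  then show ?thesis
    by (simp flip: 1(2,3))
qed

text \<open>Pitfall: \<open>bernoulli_pmf\<close> truncates its parameter to \<open>[0, 1]\<close>.\<close>

lemma rel_pmf_bernoulli_pmf:
  assumes "p \<le> q"
  shows "rel_pmf (\<longrightarrow>) (bernoulli_pmf p) (bernoulli_pmf q)"
proof -
  have clamp: "bernoulli_pmf x = bernoulli_pmf (min 1 (max 0 x))" for x
    by (rule pmf_eqI) (simp add: bernoulli_pmf.rep_eq)
  define p' q' where "p' = min 1 (max 0 p)" and "q' = min 1 (max 0 q)"
  have pq: "0 \<le> p'" "p' \<le> q'" "q' \<le> 1"
    using assms by (auto simp: p'_def q'_def)
  \<comment> \<open>If \<open>q' = 0\<close>, then \<open>p' = 0\<close> and the quotient is 0 by
    convention, so the last identity still holds.\<close>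
  then have r: "0 \<le> p' / q'" "p' / q' \<le> 1" "p' / q' * q' = p'"
    by (auto simp: divide_le_eq_1)
  let ?B = "bernoulli_pmf (p' / q')"
  \<comment> \<open>Thinning: an event of probability \<open>q'\<close> is kept with probability
    \<open>p' / q'\<close>, so the kept event has probability \<open>p'\<close> and implies the
    original one.\<close>
  let ?J = "bind_pmf (bernoulli_pmf q') (\<lambda>b. map_pmf (\<lambda>c. (b \<and> c, b)) ?B)"
  have "map_pmf fst ?J = bind_pmf (bernoulli_pmf q') (\<lambda>b. if b then ?B else return_pmf False)"
    unfolding map_bind_pmf by (intro bind_pmf_cong) (auto simp: pmf.map_comp comp_def)
  also have "\<dots> = bernoulli_pmf p'"
  proof (rule pmf_eqI)
    fix b
    show "pmf (bind_pmf (bernoulli_pmf q') (\<lambda>b. if b then ?B else return_pmf False)) b =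
        pmf (bernoulli_pmf p') b"
      using pq r by (cases b) (auto simp: pmf_bind algebra_simps)
  qed
  finally have "map_pmf fst ?J = bernoulli_pmf p'" .
  moreover have "map_pmf snd ?J = bernoulli_pmf q'"
    by (simp add: map_bind_pmf pmf.map_comp comp_def bind_return_pmf')
  ultimately have "rel_pmf (\<longrightarrow>) (bernoulli_pmf p') (bernoulli_pmf q')"
    by (intro rel_pmf.intros[of ?J]) auto
  then show ?thesis
    unfolding p'_def q'_def by (simp flip: clamp)
qed

text \<open>Drops are coupled so that a drop in the first system forces one in the second; without a
  drop the first age is 1, the least possible. The conjunct \<open>1 \<le> t\<close> is carried
  along because \<open>g\<close> is monotone only from 1 on.\<close>

lemma rel_pmf_aoi_step:
  assumes "1 \<le> \<tau> n" "\<tau> n \<le> \<tau>' n"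
    and "\<And>m. a n = Some m \<Longrightarrow> p n m (H n m) \<le> p n m (H' n m)"
  shows "rel_pmf (\<lambda>t t'. 1 \<le> t \<and> t \<le> t') (aoi_step p (\<tau>, H) a n) (aoi_step p (\<tau>', H') a n)"
proof (cases "a n")
  case None
  then show ?thesis
    using assms by (simp add: aoi_step_def)
next
  case (Some m)
  have "rel_pmf (\<longrightarrow>) (bernoulli_pmf (p n m (H n m))) (bernoulli_pmf (p n m (H' n m)))"
    using assms(3) Some by (intro rel_pmf_bernoulli_pmf)
  then show ?thesis
    using assms(1,2) Some by (auto simp: aoi_step_def pmf.rel_map elim!: pmf.rel_mono_strong)
qed

text \<open>Serves twice: with equal channel matrices and ordered ages in
  \<open>limit_cost_mono\<close>, and with equal ages and a worse channel in the theorem. The next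
  channel matrix is independent of state and action, so both sides share it.\<close>

lemma nn_integral_transition_mono:
  assumes "\<And>n. 1 \<le> \<tau> n" "\<And>n. \<tau> n \<le> \<tau>' n"
    and "\<And>n m. a n = Some m \<Longrightarrow> p n m (H n m) \<le> p n m (H' n m)"
    and f: "\<And>\<tau> \<tau>' H. (\<And>n. 1 \<le> \<tau> n) \<Longrightarrow> (\<And>n. \<tau> n \<le> \<tau>' n) \<Longrightarrow> f (\<tau>, H) \<le> f (\<tau>', H)"
  shows "(\<integral>\<^sup>+s. f s \<partial>transition p PH (\<tau>, H) a) \<le> (\<integral>\<^sup>+s. f s \<partial>transition p PH (\<tau>', H') a)"
proof -
  have "rel_pmf (\<lambda>\<sigma> \<sigma>'. \<forall>n\<in>UNIV. 1 \<le> \<sigma> n \<and> \<sigma> n \<le> \<sigma>' n)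
      (Pi_pmf UNIV 0 (aoi_step p (\<tau>, H) a)) (Pi_pmf UNIV 0 (aoi_step p (\<tau>', H') a))"
    by (intro rel_pmf_Pi_pmf rel_pmf_aoi_step assms) auto
  then show ?thesis
    unfolding transition_def nn_integral_pair_pmf'
    by (rule nn_integral_mono_rel_pmf) (auto intro!: nn_integral_mono f)
qed

section \<open>Monotonicity of costs in the AoI vector\<close>

lemma reward_antimono:
  assumes "\<And>n. mono_on {1..} (g n)" "\<And>n. 1 \<le> \<tau> n" "\<And>n. \<tau> n \<le> \<tau>' n"
  shows "reward g (\<tau>', H') \<le> reward g (\<tau>, H)"
  unfolding reward_def
  by (auto intro!: sum_mono mono_onD[OF assms(1)] assms(2,3) order_trans[OF assms(2,3)])

text \<open>Induction over the iterates: ordered ages give ordered immediate costs and, action by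
  action, ordered expected continuation costs. Infima and the final supremum preserve the
  order.\<close>

lemma limit_cost_mono:
  assumes g: "\<And>n. mono_on {1..} (g n)"
    and "\<And>n. 1 \<le> \<tau> n" "\<And>n. \<tau> n \<le> \<tau>' n"
  shows "limit_cost \<gamma> (transition p PH) (reward g) A (\<tau>, H) \<le>
    limit_cost \<gamma> (transition p PH) (reward g) A (\<tau>', H)"
proof -
  have "value_iteration \<gamma> (transition p PH) (reward g) A T (\<tau>, H) \<le>
    value_iteration \<gamma> (transition p PH) (reward g) A T (\<tau>', H)" for T
    using assms(2,3)
  proof (induction T arbitrary: \<tau> \<tau>' H)
    case (Suc T)
    show ?case
      unfolding value_iteration.simps
      by (intro add_mono mult_left_mono INF_mono' nn_integral_transition_mono Suc ennreal_leI)
         (simp_all add: reward_antimono[OF g Suc.prems])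
  qed simp
  then show ?thesis
    unfolding limit_cost_def by (rule SUP_mono')
qed

lemma set_pmf_transition:
  assumes "set_pmf PH \<subseteq> channel_matrices hmax" "s \<in> states hmax"
  shows "set_pmf (transition p PH s a) \<subseteq> states hmax"
proof -
  have "1 \<le> t" if "t \<in> set_pmf (aoi_step p s a n)" for t n
    using that by (auto simp: aoi_step_def split: prod.splits option.splits if_splits)
  then show ?thesis
    using assms(1) by (auto simp: transition_def states_def set_Pi_pmf PiE_dflt_def)
qed

section \<open>Comparison of action values for two states of one channel\<close>

theorem theorem2:
  fixes hmax :: nat
    and \<gamma> :: real
    and p :: "'n::finite \<Rightarrow> 'm::finite \<Rightarrow> nat \<Rightarrow> real"
    and q :: "'n \<Rightarrow> 'm \<Rightarrow> nat \<Rightarrow> real"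
    and PH :: "('n \<Rightarrow> 'm \<Rightarrow> nat) pmf"
    and g :: "'n \<Rightarrow> nat \<Rightarrow> real"
    and \<pi>_opt :: "('n, 'm) state \<Rightarrow> ('n, 'm) action"
    and a :: "('n, 'm) action"
    and n :: 'n and m :: 'm
    and \<tau> :: "'n \<Rightarrow> nat" and H :: "'n \<Rightarrow> 'm \<Rightarrow> nat" and h' :: nat
  assumes "CARD('m) < CARD('n)"
    and "1 \<le> hmax"
    and "0 < \<gamma>" and "\<gamma> < 1"
    and "\<forall>i j. \<forall>h\<in>{1..hmax}. 0 \<le> p i j h \<and> p i j h \<le> 1"
    and "\<forall>i j. mono_on {1..hmax} (p i j)"
    and "set_pmf PH \<subseteq> channel_matrices hmax"
    and "\<forall>i j. \<forall>h\<in>{1..hmax}. measure_pmf.prob PH {G. G i j = h} = q i j h"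
    and "\<forall>i j. (\<Sum>h=1..hmax. q i j h) = 1"
    and "\<forall>i. \<forall>t\<ge>1. 0 < g i t"
    and "\<forall>i. mono_on {1..} (g i)"
    and "optimal_stationary_policy \<gamma> (transition p PH) (reward g) (states hmax) admissible \<pi>_opt"
    and "\<forall>s\<in>states hmax. \<bar>V_fun \<gamma> (transition p PH) (reward g) \<pi>_opt s\<bar> \<noteq> \<infinity>"
    and "\<forall>s\<in>states hmax. \<forall>b\<in>admissible. \<bar>Q_fun \<gamma> (transition p PH) (reward g) \<pi>_opt s b\<bar> \<noteq> \<infinity>"
    and "a \<in> admissible"
    and "(\<tau>, H) \<in> states hmax"
    and "(\<tau>, H(n := (H n)(m := h'))) \<in> states hmax"
    and "H n m < h'"
  shows "(a n = Some m \<longrightarrow>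
            Q_fun \<gamma> (transition p PH) (reward g) \<pi>_opt (\<tau>, H(n := (H n)(m := h'))) a
              \<le> Q_fun \<gamma> (transition p PH) (reward g) \<pi>_opt (\<tau>, H) a)
       \<and> (a n \<noteq> Some m \<longrightarrow>
            Q_fun \<gamma> (transition p PH) (reward g) \<pi>_opt (\<tau>, H(n := (H n)(m := h'))) a
              = Q_fun \<gamma> (transition p PH) (reward g) \<pi>_opt (\<tau>, H) a)"
proof -
  let ?K = "transition p PH" and ?r = "reward g" and ?H' = "H(n := (H n)(m := h'))"
  have \<gamma>: "0 \<le> \<gamma>"
    using assms(3) by simp
  have cost: "policy_cost \<gamma> ?K ?r \<pi>_opt s = limit_cost \<gamma> ?K ?r admissible s" if "s \<in> states hmax" for s
    by (rule policy_cost_optimal[OF \<gamma> _ assms(12) set_pmf_transition[OF assms(7)] that]) auto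
  have Q: "Q_fun \<gamma> ?K ?r \<pi>_opt s a = - enn2ereal (ennreal (- ?r s) +
      ennreal \<gamma> * (\<integral>\<^sup>+s'. limit_cost \<gamma> ?K ?r admissible s' \<partial>?K s a))" if "s \<in> states hmax" for s
  proof -
    \<comment> \<open>Both costs are known to agree only on \<open>states hmax\<close>, which
      contains all successors.\<close>
    have "(\<integral>\<^sup>+s'. policy_cost \<gamma> ?K ?r \<pi>_opt s' \<partial>?K s a) =
        (\<integral>\<^sup>+s'. limit_cost \<gamma> ?K ?r admissible s' \<partial>?K s a)"
      using set_pmf_transition[OF assms(7) that, of p a]
      by (intro nn_integral_cong_AE) (auto simp: AE_measure_pmf_iff cost)
    then show ?thesis
      by (simp add: Q_fun_eq[OF \<gamma>])
  qed
  have r: "?r (\<tau>, ?H') = ?r (\<tau>, H)"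
    by (simp add: reward_def)
  have \<tau>: "1 \<le> \<tau> i" for i
    using assms(16) by (auto simp: states_def)
  \<comment> \<open>Both values must lie in the range on which \<open>p n m\<close> is
    monotone.\<close>
  have "H n m \<in> {1..hmax}" "?H' n m \<in> {1..hmax}"
    using assms(16,17) unfolding states_def channel_matrices_def by blast+
  then have "p n m (H n m) \<le> p n m h'"
    using assms(6,18) mono_onD[of "{1..hmax}" "p n m" "H n m" h'] by simp
  \<comment> \<open>This holds for every assignment \<open>a n\<close>: only the entry
    \<open>(n, m)\<close> differs, and there the drop probability does not decrease.\<close>
  then have "(\<integral>\<^sup>+s. limit_cost \<gamma> ?K ?r admissible s \<partial>?K (\<tau>, H) a) \<le>
      (\<integral>\<^sup>+s. limit_cost \<gamma> ?K ?r admissible s \<partial>?K (\<tau>, ?H') a)"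
    using assms(11) \<tau> by (intro nn_integral_transition_mono limit_cost_mono) auto
  then have "Q_fun \<gamma> ?K ?r \<pi>_opt (\<tau>, ?H') a \<le> Q_fun \<gamma> ?K ?r \<pi>_opt (\<tau>, H) a"
    unfolding Q[OF assms(16)] Q[OF assms(17)] r ereal_minus_le_minus less_eq_ennreal.rep_eq[symmetric]
    by (intro add_left_mono mult_left_mono) simp_all
  \<comment> \<open>The transition reads the entry \<open>(n, m)\<close> only if device
    \<open>n\<close> is scheduled on channel \<open>m\<close>.\<close>
  moreover have "aoi_step p (\<tau>, ?H') a = aoi_step p (\<tau>, H) a" if "a n \<noteq> Some m"
    using that by (intro ext) (auto simp: aoi_step_def split: option.splits)
  then have "Q_fun \<gamma> ?K ?r \<pi>_opt (\<tau>, ?H') a = Q_fun \<gamma> ?K ?r \<pi>_opt (\<tau>, H) a" if "a n \<noteq> Some m"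
    unfolding Q[OF assms(16)] Q[OF assms(17)] r using that by (simp add: transition_def)
  ultimately show ?thesis
    by blast
qed

end
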